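(* Let $n\ge r\ge1$ be integers and $q$ a prime power. There exists a Kakeya set $K\subseteq\mathbb{F}_q^n$ of rank $r$ such that $$|K|\le\big(1-(1-q^{-\lfloor n/q^r\rfloor})^{q^r}\big)q^n.$$
   Context: $\mathbb{F}_q$ denotes the finite field with $q$ elements. For a finite vector space $V$ and an integer $0\le r\le\dim V$, a subset $K\subseteq V$ is a Kakeya set of rank $r$ if for every subspace $L\le V$ with $\dim L=r$ there exists $v\in V$ such that $v+L\subseteq K$. *)

theory Defs
  imports "HOL-Analysis.Cartesian_Space" "HOL-Number_Theory.Prime_Powers"
begin

text \<open>
  Subspaces and dimensions are those of the vector space \<open>'a ^ 'n\<close> over the finite field
  \<open>'a\<close> (the interpretation \<open>vec\<close>, with scalar multiplication \<open>(*s)\<close>), not those of the real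
  vector space structure. The notion is meant for \<open>r \<le> CARD('n)\<close>; for larger \<open>r\<close> it holds
  vacuously.
\<close>

definition kakeya_set :: "nat \<Rightarrow> ('a::{field,finite} ^ 'n::finite) set \<Rightarrow> bool" where
  "kakeya_set r K \<longleftrightarrow>
     (\<forall>L :: ('a ^ 'n) set. vec.subspace L \<longrightarrow> vec.dim L = r \<longrightarrow> (\<exists>v. (\<lambda>x. v + x) ` L \<subseteq> K))"

end

theory Submission
  imports Defs "HOL-Library.Disjoint_Sets"
begin

text \<open>
  Put \<open>N = q ^ r\<close> and choose \<open>N\<close> disjoint blocks of \<open>n div N\<close> coordinates each. Let \<open>K\<close> consist of
  the vectors that vanish identically on at least one block; the complement of \<open>K\<close> is a product and
  is easily counted. A subspace \<open>L\<close> of dimension \<open>r\<close> has at most \<open>N\<close> elements, so distinct elements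
  \<open>x\<close> of \<open>L\<close> can be assigned distinct blocks. If \<open>v\<close> agrees with \<open>- x\<close> on the block of \<open>x\<close>
  for each \<open>x\<close>, then \<open>v + L \<subseteq> K\<close>.
\<close>

text \<open>Coefficient functions on a basis of \<open>L\<close> reach every element of
  \<open>L\<close>, and there are \<open>CARD('a) ^ vec.dim L\<close> of them. The upper bound is
  all that assigning blocks to elements requires.\<close>

lemma card_subspace_le:
  fixes L :: "('a::{field,finite} ^ 'n::finite) set"
  assumes "vec.subspace L"
  shows "card L \<le> CARD('a) ^ vec.dim L"
proof -
  obtain B where B: "B \<subseteq> L" "vec.independent B" "L \<subseteq> vec.span B" "card B = vec.dim L"
    using vec.basis_exists by blast
  have "x \<in> (\<lambda>u. \<Sum>v\<in>B. u v *s v) ` (B \<rightarrow>\<^sub>E (UNIV :: 'a set))" if "x \<in> L" for x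
  proof -
    from that B(3) obtain u where "x = (\<Sum>v\<in>B. u v *s v)"
      using vec.span_finite[of B] by auto
    \<comment> \<open>Restricting makes the coefficient function a member of the finite set
      \<open>B \<rightarrow>\<^sub>E UNIV\<close>, without changing the sum.\<close>
    then have "x = (\<Sum>v\<in>B. restrict u B v *s v)"
      by simp
    then show ?thesis
      by (intro image_eqI[of _ _ "restrict u B"]) auto
  qed
  then have "card L \<le> card ((\<lambda>u. \<Sum>v\<in>B. u v *s v) ` (B \<rightarrow>\<^sub>E (UNIV :: 'a set)))"
    by (intro card_mono) (auto intro!: finite_imageI finite_PiE)
  also have "\<dots> \<le> card (B \<rightarrow>\<^sub>E (UNIV :: 'a set))"
    by (intro card_image_le finite_PiE) auto
  also have "\<dots> = CARD('a) ^ vec.dim L"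
    using B(4) by (simp add: card_PiE)
  finally show ?thesis .
qed

text \<open>Enumerate \<open>A\<close> as 0, 1, 2, ... and cut the enumeration into consecutive
  intervals of length \<open>m\<close>; the first \<open>N\<close> of them fit because
  \<open>N * m \<le> card A\<close>.\<close>

lemma ex_disjoint_blocks:
  assumes "finite A" and "N * m \<le> card A"
  obtains B :: "nat \<Rightarrow> 'b set"
  where "disjoint_family_on B {..<N}" and "\<And>k. k < N \<Longrightarrow> B k \<subseteq> A \<and> card (B k) = m"
proof -
  obtain h where h: "bij_betw h {0..<card A} A"
    using ex_bij_betw_nat_finite[OF assms(1)] by blast
  define B where "B k = h ` {k * m..<Suc k * m}" for k
  have sub: "{k * m..<Suc k * m} \<subseteq> {0..<card A}" if "k < N" for k
  proof -
    have "Suc k * m \<le> N * m"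
      using that by (intro mult_le_mono1) simp
    then show ?thesis
      using assms(2) by auto
  qed
  have "B k \<subseteq> A \<and> card (B k) = m" if "k < N" for k
  proof
    show "B k \<subseteq> A"
      using sub[OF that] h unfolding B_def bij_betw_def by blast
    have "inj_on h {k * m..<Suc k * m}"
      using sub[OF that] h inj_on_subset unfolding bij_betw_def by blast
    then show "card (B k) = m"
      unfolding B_def by (simp add: card_image)
  qed
  moreover have "disjoint_family_on B {..<N}"
    unfolding disjoint_family_on_def
  proof (intro ballI impI)
    fix k l assume kl: "k \<in> {..<N}" "l \<in> {..<N}" "k \<noteq> l"
    have "{k * m..<Suc k * m} \<inter> {l * m..<Suc l * m} = {}"
    proof (rule ccontr)
      assume "{k * m..<Suc k * m} \<inter> {l * m..<Suc l * m} \<noteq> {}"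
      then obtain i where "k * m \<le> i" "i < Suc k * m" "l * m \<le> i" "i < Suc l * m"
        by (metis atLeastLessThan_iff disjoint_iff)
      \<comment> \<open>The quotient by \<open>m\<close> recovers the interval in which an index
        lies.\<close>
      then have "i div m = k" "i div m = l"
        by (auto intro!: div_nat_eqI simp: mult.commute)
      with kl show False by simp
    qed
    moreover have "inj_on h {0..<card A}" "{k * m..<Suc k * m} \<subseteq> {0..<card A}"
      "{l * m..<Suc l * m} \<subseteq> {0..<card A}"
      using h sub kl by (simp_all add: bij_betw_def)
    ultimately show "B k \<inter> B l = {}"
      unfolding B_def by (metis image_empty inj_on_image_Int)
  qed
  ultimately show ?thesis
    using that by blast
qed

text \<open>Conditions on disjoint blocks are independent: each block admits every pattern except
  the zero one, and the coordinates outside all blocks are free. The domain \<open>A\<close> is kept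
  general so that the induction can remove one block from it.\<close>

lemma card_PiE_nonzero_on_blocks:
  fixes B :: "'k \<Rightarrow> 'i set"
  assumes "finite J" and "finite A" and "disjoint_family_on B J"
    and "\<And>k. k \<in> J \<Longrightarrow> B k \<subseteq> A \<and> card (B k) = m"
  shows "card {f \<in> A \<rightarrow>\<^sub>E (UNIV :: 'a::{zero,finite} set). \<forall>k\<in>J. \<exists>i\<in>B k. f i \<noteq> 0}
       = (CARD('a) ^ m - 1) ^ card J * CARD('a) ^ (card A - card J * m)"
  using assms
proof (induction J arbitrary: A rule: finite_induct)
  case empty
  then show ?case by (simp add: card_PiE)
next
  case (insert k J)
  let ?U = "UNIV :: 'a set"
  let ?C = "A - B k"
  let ?X = "{f \<in> B k \<rightarrow>\<^sub>E ?U. \<exists>i\<in>B k. f i \<noteq> 0}"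
  let ?Y = "{f \<in> ?C \<rightarrow>\<^sub>E ?U. \<forall>j\<in>J. \<exists>i\<in>B j. f i \<noteq> 0}"
  let ?Z = "{f \<in> A \<rightarrow>\<^sub>E ?U. \<forall>j\<in>insert k J. \<exists>i\<in>B j. f i \<noteq> 0}"
  have Bk: "B k \<subseteq> A" "card (B k) = m" and fin: "finite (B k)"
    using insert.prems(1) insert.prems(3)[of k] finite_subset[of "B k" A] by auto
  have BJ: "B j \<subseteq> ?C" if "j \<in> J" for j
  proof -
    have "B j \<inter> B k = {}"
      using insert.prems(2) insert.hyps that unfolding disjoint_family_on_def by force
    with insert.prems(3)[of j] that show ?thesis by blast
  qed
  \<comment> \<open>A function on \<open>A\<close> is the same as a pair of functions on
    \<open>B k\<close> and on the rest. The condition for \<open>k\<close> concerns only the first,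
    and by disjointness the others concern only the second.\<close>
  have "card ?Z = card (?X \<times> ?Y)"
  proof (rule bij_betw_same_card)
    show "bij_betw (\<lambda>f. (restrict f (B k), restrict f ?C)) ?Z (?X \<times> ?Y)"
    proof (rule bij_betw_byWitness[where f' = "\<lambda>(g, h) i. if i \<in> B k then g i else h i"])
      show "\<forall>f\<in>?Z. (case (restrict f (B k), restrict f ?C) of
          (g, h) \<Rightarrow> \<lambda>i. if i \<in> B k then g i else h i) = f"
      proof
        fix f assume "f \<in> ?Z"
        \<comment> \<open>Gluing the two restrictions yields \<open>undefined\<close> outside
          \<open>A\<close>, so \<open>f\<close> has to agree with that there.\<close>
        then have "f i = undefined" if "i \<notin> A" for i
          using that PiE_arb[of f A "\<lambda>_. ?U"] by blast
        then show "(case (restrict f (B k), restrict f ?C) of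
            (g, h) \<Rightarrow> \<lambda>i. if i \<in> B k then g i else h i) = f"
          by (simp add: fun_eq_iff)
      qed
      show "\<forall>p\<in>?X \<times> ?Y. (restrict (case p of (g, h) \<Rightarrow> \<lambda>i. if i \<in> B k then g i else h i) (B k),
          restrict (case p of (g, h) \<Rightarrow> \<lambda>i. if i \<in> B k then g i else h i) ?C) = p"
      proof
        fix p assume p: "p \<in> ?X \<times> ?Y"
        then have "fst p i = undefined" if "i \<notin> B k" for i
          using that PiE_arb[of "fst p" "B k" "\<lambda>_. ?U"] by (simp add: mem_Times_iff)
        moreover have "snd p i = undefined" if "i \<notin> ?C" for i
          using p that PiE_arb[of "snd p" ?C "\<lambda>_. ?U"] by (simp add: mem_Times_iff)
        ultimately show "(restrict (case p of (g, h) \<Rightarrow> \<lambda>i. if i \<in> B k then g i else h i) (B k),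
            restrict (case p of (g, h) \<Rightarrow> \<lambda>i. if i \<in> B k then g i else h i) ?C) = p"
          by (simp add: prod_eq_iff fun_eq_iff case_prod_unfold)
      qed
      show "(\<lambda>f. (restrict f (B k), restrict f ?C)) ` ?Z \<subseteq> ?X \<times> ?Y"
      proof (intro image_subsetI SigmaI)
        fix f :: "'i \<Rightarrow> 'a"
        assume f: "f \<in> ?Z"
        then show "restrict f (B k) \<in> ?X"
          by auto
        have "\<exists>i\<in>B j. restrict f ?C i \<noteq> 0" if "j \<in> J" for j
        proof -
          from f that obtain i where "i \<in> B j" "f i \<noteq> 0"
            by blast
          with BJ[OF that] show ?thesis
            by (intro bexI[of _ i]) auto
        qed
        then show "restrict f ?C \<in> ?Y"
          by auto
      qed
      show "(\<lambda>(g, h) i. if i \<in> B k then g i else h i) ` (?X \<times> ?Y) \<subseteq> ?Z"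
      proof (intro image_subsetI, elim SigmaE, hypsubst, unfold case_prod_conv)
        fix g h :: "'i \<Rightarrow> 'a"
        assume g: "g \<in> ?X" and h: "h \<in> ?Y"
        let ?f = "\<lambda>i. if i \<in> B k then g i else h i"
        have "?f \<in> A \<rightarrow>\<^sub>E ?U"
          using g h Bk(1) by (auto simp: PiE_iff extensional_def)
        moreover have "\<exists>i\<in>B k. ?f i \<noteq> 0"
          using g by auto
        moreover have "\<exists>i\<in>B j. ?f i \<noteq> 0" if "j \<in> J" for j
        proof -
          from h that obtain i where "i \<in> B j" "h i \<noteq> 0"
            by blast
          with BJ[OF that] show ?thesis
            by (intro bexI[of _ i]) auto
        qed
        ultimately show "?f \<in> ?Z"
          by blast
      qed
    qed
  qed
  moreover have "card ?X = CARD('a) ^ m - 1"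
  proof -
    \<comment> \<open>Exactly one function is excluded: the zero function, restricted so as to be
      extensional on \<open>B k\<close>.\<close>
    have "(\<exists>i\<in>B k. f i \<noteq> 0) \<longleftrightarrow> f \<noteq> restrict (\<lambda>_. 0) (B k)" if "f \<in> B k \<rightarrow>\<^sub>E ?U" for f
      using that PiE_ext[of f "B k" "\<lambda>_. ?U" "restrict (\<lambda>_. 0) (B k)"] by auto
    then have "?X = (B k \<rightarrow>\<^sub>E ?U) - {restrict (\<lambda>_. 0) (B k)}"
      by blast
    then have "card ?X = card (B k \<rightarrow>\<^sub>E ?U) - 1"
      using fin by (simp add: card_Diff_singleton)
    then show ?thesis
      using fin Bk by (simp add: card_PiE)
  qed
  moreover have "card ?Y = (CARD('a) ^ m - 1) ^ card J * CARD('a) ^ (card ?C - card J * m)"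
    using insert.prems BJ
    by (intro insert.IH) (auto simp: disjoint_family_on_def)
  moreover have "card ?C = card A - m"
    using Bk fin by (simp add: card_Diff_subset)
  ultimately show ?case
    using insert.hyps by (simp add: card_cartesian_product algebra_simps)
qed

lemma card_vec_nonzero_on_blocks:
  fixes B :: "'k \<Rightarrow> 'n::finite set"
  assumes "finite J" and "disjoint_family_on B J" and "\<And>k. k \<in> J \<Longrightarrow> card (B k) = m"
  shows "card {x :: 'a::{zero,finite} ^ 'n. \<forall>k\<in>J. \<exists>i\<in>B k. x $ i \<noteq> 0}
       = (CARD('a) ^ m - 1) ^ card J * CARD('a) ^ (CARD('n) - card J * m)"
proof -
  have "bij_betw (\<lambda>x i. x $ i) {x :: 'a ^ 'n. \<forall>k\<in>J. \<exists>i\<in>B k. x $ i \<noteq> 0}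
      {f \<in> UNIV \<rightarrow>\<^sub>E UNIV. \<forall>k\<in>J. \<exists>i\<in>B k. f i \<noteq> 0}"
    by (rule bij_betw_byWitness[where f' = vec_lambda]) auto
  from bij_betw_same_card[OF this] show ?thesis
    using card_PiE_nonzero_on_blocks[of J UNIV B m, where 'a = 'a] assms by simp
qed

lemma kakeya_set_zero_on_some_block:
  fixes B :: "nat \<Rightarrow> 'n::finite set"
  assumes "disjoint_family_on B {..<CARD('a) ^ r}"
  shows "kakeya_set r {x :: 'a::{field,finite} ^ 'n. \<exists>k<CARD('a) ^ r. \<forall>i\<in>B k. x $ i = 0}"
  unfolding kakeya_set_def
proof (intro allI impI)
  fix L :: "('a ^ 'n) set"
  assume "vec.subspace L" "vec.dim L = r"
  then have "card L \<le> card {..<CARD('a) ^ r}"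
    using card_subspace_le by auto
  then obtain e where e: "e ` L \<subseteq> {..<CARD('a) ^ r}" "inj_on e L"
    using card_le_inj[of L "{..<CARD('a) ^ r}"] by auto
  \<comment> \<open>A coordinate \<open>i\<close> lies in the block of at most one element of
    \<open>L\<close>, since the blocks are disjoint and \<open>e\<close> is injective. On
    coordinates in no assigned block the value of \<open>THE\<close> is arbitrary, which does no
    harm.\<close>
  define v :: "'a ^ 'n" where "v = (\<chi> i. - ((THE x. x \<in> L \<and> i \<in> B (e x)) $ i))"
  have "\<forall>i\<in>B (e x). (v + x) $ i = 0" if "x \<in> L" for x
  proof
    fix i assume i: "i \<in> B (e x)"
    have "y = x" if "y \<in> L" "i \<in> B (e y)" for y
    proof -
      have "e y = e x"
        using disjoint_family_onD[OF assms, of "e y" "e x"] e(1) i that \<open>x \<in> L\<close> by blast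
      then show ?thesis
        using e(2) that \<open>x \<in> L\<close> by (auto dest: inj_onD)
    qed
    then have "(THE x. x \<in> L \<and> i \<in> B (e x)) = x"
      using i \<open>x \<in> L\<close> by (intro the_equality) blast+
    then show "(v + x) $ i = 0"
      by (simp add: v_def)
  qed
  then show "\<exists>v. (\<lambda>x. v + x) ` L \<subseteq> {x. \<exists>k<CARD('a) ^ r. \<forall>i\<in>B k. x $ i = 0}"
    using e(1) by (intro exI[of _ v]) blast
qed

theorem theorem6:
  fixes n r q :: nat
  assumes "1 \<le> r" and "r \<le> n"
    and "primepow q"
    and "CARD('a::{field,finite}) = q"
    and "CARD('n::finite) = n"
  shows "\<exists>K :: ('a ^ 'n) set. kakeya_set r K \<and>
           real (card K) \<le> (1 - (1 - real q powi (- int (n div q ^ r))) ^ (q ^ r)) * real q ^ n"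
proof -
  \<comment> \<open>If \<open>n < q ^ r\<close>, then \<open>m = 0\<close>: all blocks are empty,
    \<open>K\<close> below is the whole space, and the claimed bound is
    \<open>q ^ n\<close>.\<close>
  define N m where "N = q ^ r" and "m = n div N"
  have "q > 0"
    using primepow_gt_0_nat[OF assms(3)] .
  have Nm: "N * m \<le> n"
    unfolding m_def by simp
  then obtain B :: "nat \<Rightarrow> 'n set"
    where disj: "disjoint_family_on B {..<N}" and card: "\<And>k. k < N \<Longrightarrow> card (B k) = m"
    using ex_disjoint_blocks[of "UNIV :: 'n set" N m] assms(5) by auto
  define K :: "('a ^ 'n) set" where "K = {x. \<exists>k<N. \<forall>i\<in>B k. x $ i = 0}"
  have "- K = {x. \<forall>k\<in>{..<N}. \<exists>i\<in>B k. x $ i \<noteq> 0}"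
    unfolding K_def by auto
  then have "card (- K) = (q ^ m - 1) ^ N * q ^ (n - N * m)"
    using card_vec_nonzero_on_blocks[of "{..<N}" B m, where 'a = 'a] disj card assms(4,5)
    by simp
  then have "real (card (- K)) = (real q ^ m - 1) ^ N * real q ^ (n - N * m)"
    using \<open>q > 0\<close> by (simp add: of_nat_diff)
  \<comment> \<open>Extracting \<open>q ^ m\<close> from each of the \<open>N\<close> block factors
    lets these powers combine with those of the free coordinates to \<open>q ^ n\<close>.\<close>
  also have "\<dots> = ((1 - real q powi (- int m)) * real q ^ m) ^ N * real q ^ (n - N * m)"
    using \<open>q > 0\<close> by (simp add: power_int_minus algebra_simps)
  also have "\<dots> = (1 - real q powi (- int m)) ^ N * (real q ^ (N * m) * real q ^ (n - N * m))"
    by (simp add: power_mult_distrib mult.commute flip: power_mult)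
  also have "real q ^ (N * m) * real q ^ (n - N * m) = real q ^ n"
    using Nm by (simp flip: power_add)
  finally have compl: "real (card (- K)) = (1 - real q powi (- int m)) ^ N * real q ^ n" .
  have "card K + card (- K) = q ^ n"
    using card_Un_disjoint[of K "- K"] assms(4,5) by simp
  then have "real (card K) = real q ^ n - real (card (- K))"
    by (metis add_diff_cancel_right' of_nat_add of_nat_power)
  \<comment> \<open>The count is exact, so this \<open>K\<close> attains the bound with
    equality.\<close>
  then have "real (card K) = (1 - (1 - real q powi (- int m)) ^ N) * real q ^ n"
    unfolding compl by (simp add: algebra_simps)
  moreover have "kakeya_set r K"
    using kakeya_set_zero_on_some_block[of B r, where 'a = 'a] disj assms(4)
    unfolding K_def N_def by simp
  ultimately show ?thesis
    unfolding N_def m_def by auto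
qed

end
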